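(* For every pair $(A,B) \in \{(36,30), (72,42), (196,70), (252,114)\}$ and every integer $n \geq 0$, we have $\overline{p}(An+B) \equiv 0 \pmod{16}$.
   Context: An overpartition of $m$ is a partition of $m$ in which the last (final) appearance of each distinct part size may be overlined or not; $\overline{p}(m)$ denotes the number of overpartitions of $m$. Equivalently, $\sum_{m \geq 0} \overline{p}(m) q^m = \prod_{k \geq 1} \frac{1+q^k}{1-q^k}$. *)

theory Defs
  imports "HOL-Number_Theory.Number_Theory"
begin

(* The parts are listed in weakly decreasing order as pairs (size, overlined?).
   The last condition says that only the final appearance of a size can be overlined. *)
definition is_overpartition :: "nat \<Rightarrow> (nat \<times> bool) list \<Rightarrow> bool" where
  "is_overpartition m xs \<longleftrightarrow>
     sorted_wrt (\<ge>) (map fst xs) \<and>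
     (\<forall>x\<in>set xs. fst x > 0) \<and>
     sum_list (map fst xs) = m \<and>
     (\<forall>i j. i < j \<and> j < length xs \<and> fst (xs ! i) = fst (xs ! j) \<longrightarrow> \<not> snd (xs ! i))"

definition overp :: "nat \<Rightarrow> nat" where
  "overp m = card {xs. is_overpartition m xs}"

lemma finite_overpartitions: "finite {xs. is_overpartition m xs}"
proof (rule finite_subset)
  have len: "length xs \<le> sum_list (map fst xs)" if "\<forall>x\<in>set xs. fst x > 0"
    for xs :: "(nat \<times> bool) list"
    using that by (induction xs) auto
  show "{xs. is_overpartition m xs} \<subseteq> {xs. set xs \<subseteq> {..m} \<times> UNIV \<and> length xs \<le> m}"
  proof (safe)
    fix xs k b assume *: "is_overpartition m xs" "(k, b) \<in> set xs"
    then have "k \<in> set (map fst xs)" by force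
    then show "k \<le> m"
      using * member_le_sum_list[of k "map fst xs"] by (simp add: is_overpartition_def)
  next
    fix xs assume "is_overpartition m xs"
    then show "length xs \<le> m" using len by (auto simp: is_overpartition_def)
  qed simp
  show "finite {xs. set xs \<subseteq> {..m} \<times> (UNIV :: bool set) \<and> length xs \<le> m}"
    by (rule finite_lists_length_le) simp
qed

end

theory Submission
  imports Defs "HOL-Computational_Algebra.Formal_Power_Series" "HOL-Library.Disjoint_Sets"
    "HOL-Library.Z2"
begin

text \<open>
  By Gauss, the generating function of overpartitions is the inverse of
  \<open>\<phi>(-q) = 1 + 2\<theta>\<close> with \<open>\<theta> = \<Sum>\<^sub>j\<^sub>\<ge>\<^sub>1 (-1)\<^sup>j q\<^bsup>j\<^sup>2\<^esup>\<close>, hence congruent to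
  \<open>1 - 2\<theta> + 4\<theta>\<^sup>2 - 8\<theta>\<^sup>3\<close> modulo 16.
  In each progression a prime \<open>p \<in> {3, 7}\<close> divides \<open>N = An + B\<close> exactly once, so \<open>N\<close> is not a sum
  of two squares and \<open>\<theta>\<close>, \<open>\<theta>\<^sup>2\<close> have no \<open>q\<^sup>N\<close> term.
  Since \<open>\<theta>(q)\<^sup>2\<close> and \<open>\<theta>(q\<^sup>2)\<close> agree modulo 2, the coefficient of \<open>\<theta>\<^sup>3\<close> has the parity of the
  number of positive solutions of \<open>x\<^sup>2 + 2y\<^sup>2 = N\<close>.
  There are none if \<open>p = 7\<close>, as \<open>-2\<close> is not a square modulo 7.
  If \<open>p = 3\<close>, the factorisation \<open>3 = (1 + \<surd>-2)(1 - \<surd>-2)\<close> yields an involution on the solutions,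
  whose fixed points would force \<open>N = 3s\<^sup>2\<close> or \<open>N = 6s\<^sup>2\<close>.
\<close>

unbundle fps_syntax

section \<open>The generating function of overpartitions\<close>

lemma is_overpartition_Cons:
  "is_overpartition m ((a, b) # xs) \<longleftrightarrow>
     0 < a \<and> a \<le> m \<and> (\<forall>x\<in>set xs. fst x \<le> a) \<and> (b \<longrightarrow> (\<forall>x\<in>set xs. fst x \<noteq> a)) \<and>
     is_overpartition (m - a) xs"
proof -
  \<comment> \<open>The overlining condition constrains pairs of positions only, so as a
    \<open>sorted_wrt\<close> it unfolds along \<open>Cons\<close>.\<close>
  have *: "(\<forall>i j. i < j \<and> j < length ys \<and> fst (ys ! i) = fst (ys ! j) \<longrightarrow> \<not> snd (ys ! i)) \<longleftrightarrow>
      sorted_wrt (\<lambda>x y. fst x = fst y \<longrightarrow> \<not> snd x) ys" for ys :: "(nat \<times> bool) list"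
    by (auto simp: sorted_wrt_iff_nth_less)
  show ?thesis
    unfolding is_overpartition_def * by auto
qed

definition bounded_overpartitions :: "nat \<Rightarrow> nat \<Rightarrow> (nat \<times> bool) list set" where
  "bounded_overpartitions k m = {xs. is_overpartition m xs \<and> (\<forall>x\<in>set xs. fst x \<le> k)}"

lemma finite_bounded_overpartitions: "finite (bounded_overpartitions k m)"
  by (rule finite_subset[OF _ finite_overpartitions[of m]]) (auto simp: bounded_overpartitions_def)

lemma bounded_overpartitions_0: "bounded_overpartitions 0 m = (if m = 0 then {[]} else {})"
proof -
  have "xs = []" if "xs \<in> bounded_overpartitions 0 m" for xs
    using that by (cases xs) (auto simp: bounded_overpartitions_def is_overpartition_def)
  moreover have "[] \<in> bounded_overpartitions 0 m \<longleftrightarrow> m = 0"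
    by (auto simp: bounded_overpartitions_def is_overpartition_def)
  ultimately show ?thesis
    by (auto intro: Set.set_eqI)
qed

text \<open>A largest part k + 1 must be the head. If it is plain, further copies may follow; if it
  is overlined, it is the last copy, so the tail has parts at most k.\<close>

lemma bounded_overpartitions_Suc:
  "bounded_overpartitions (Suc k) m = bounded_overpartitions k m \<union>
     (if Suc k \<le> m then Cons (Suc k, False) ` bounded_overpartitions (Suc k) (m - Suc k) \<union>
        Cons (Suc k, True) ` bounded_overpartitions k (m - Suc k) else {})" (is "?L = ?R")
proof (rule Set.set_eqI)
  fix xs
  show "xs \<in> ?L \<longleftrightarrow> xs \<in> ?R"
  proof (cases xs)
    case Nil
    then show ?thesis by (auto simp: bounded_overpartitions_def)
  next
    case (Cons x ys)
    obtain a b where x: "x = (a, b)" by force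
    show ?thesis
      unfolding Cons x
      by (cases b)
        (auto simp: bounded_overpartitions_def is_overpartition_Cons image_iff le_Suc_eq)
  qed
qed

lemma card_bounded_overpartitions_Suc:
  "card (bounded_overpartitions (Suc k) m) = card (bounded_overpartitions k m) +
     (if Suc k \<le> m then card (bounded_overpartitions (Suc k) (m - Suc k)) +
        card (bounded_overpartitions k (m - Suc k)) else 0)"
proof (cases "Suc k \<le> m")
  case True
  let ?A = "bounded_overpartitions k m"
  let ?B = "Cons (Suc k, False) ` bounded_overpartitions (Suc k) (m - Suc k)"
  let ?C = "Cons (Suc k, True) ` bounded_overpartitions k (m - Suc k)"
  have "bounded_overpartitions (Suc k) m = ?A \<union> (?B \<union> ?C)"
    using bounded_overpartitions_Suc[of k m] True by simp
  moreover have "card (?A \<union> (?B \<union> ?C)) = card ?A + card (?B \<union> ?C)"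
    by (rule card_Un_disjoint; (simp add: finite_bounded_overpartitions)?)
      (auto simp: bounded_overpartitions_def)
  moreover have "card (?B \<union> ?C) = card ?B + card ?C"
    by (rule card_Un_disjoint) (auto simp: finite_bounded_overpartitions)
  ultimately show ?thesis
    using True by (simp add: card_image)
next
  case False
  then show ?thesis
    using bounded_overpartitions_Suc[of k m] by simp
qed

lemma card_bounded_overpartitions_eq_overp:
  assumes "m \<le> k"
  shows "card (bounded_overpartitions k m) = overp m"
proof -
  have "fst x \<le> k" if "is_overpartition m xs" "x \<in> set xs" for xs x
    using that assms member_le_sum_list[of "fst x" "map fst xs"]
    by (auto simp: is_overpartition_def)
  then have "bounded_overpartitions k m = {xs. is_overpartition m xs}"
    by (auto simp: bounded_overpartitions_def)
  then show ?thesis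
    by (simp add: overp_def)
qed

definition bounded_overp_fps :: "nat \<Rightarrow> int fps" where
  "bounded_overp_fps k = Abs_fps (\<lambda>m. int (card (bounded_overpartitions k m)))"

text \<open>Coefficientwise this is the recurrence G_(k+1) = G_k + q^(k+1) (G_(k+1) + G_k) given by
  the three cases for the head.\<close>

lemma bounded_overp_fps_Suc:
  "bounded_overp_fps (Suc k) * (1 - fps_X ^ Suc k) = bounded_overp_fps k * (1 + fps_X ^ Suc k)"
proof (rule fps_ext)
  fix m
  show "(bounded_overp_fps (Suc k) * (1 - fps_X ^ Suc k)) $ m =
      (bounded_overp_fps k * (1 + fps_X ^ Suc k)) $ m"
    unfolding right_diff_distrib distrib_left fps_sub_nth fps_add_nth fps_X_power_mult_right_nth
    by (auto simp: bounded_overp_fps_def card_bounded_overpartitions_Suc[of k m])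
qed

text \<open>In Pochhammer notation, \<open>q_fact n\<close> is (q;q)_n and
  \<open>q_fact_plus n\<close> below is (-q;q)_n.\<close>

definition q_fact :: "nat \<Rightarrow> int fps" where
  "q_fact n = (\<Prod>k=1..n. 1 - fps_X ^ k)"

definition q_fact_plus :: "nat \<Rightarrow> int fps" where
  "q_fact_plus n = (\<Prod>k=1..n. 1 + fps_X ^ k)"

text \<open>The integers are not a field, so the inverse is built from an explicit inverse, 1, of
  the constant coefficient.\<close>

definition q_fact_inv :: "nat \<Rightarrow> int fps" where
  "q_fact_inv n = fps_right_inverse (q_fact n) 1"

lemma q_fact_Suc: "q_fact (Suc n) = q_fact n * (1 - fps_X ^ Suc n)"
  by (simp add: q_fact_def)

lemma q_fact_plus_Suc: "q_fact_plus (Suc n) = q_fact_plus n * (1 + fps_X ^ Suc n)"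
  by (simp add: q_fact_plus_def)

lemma q_fact_nth_0: "q_fact n $ 0 = 1"
  by (induction n) (simp_all add: q_fact_Suc, simp add: q_fact_def)

lemma q_fact_mult_inv: "q_fact n * q_fact_inv n = 1"
  unfolding q_fact_inv_def by (rule fps_right_inverse) (simp add: q_fact_nth_0)

lemma q_fact_inv_Suc: "q_fact_inv (Suc n) * (1 - fps_X ^ Suc n) = q_fact_inv n"
proof -
  have "q_fact_inv (Suc n) * (1 - fps_X ^ Suc n) =
      q_fact_inv (Suc n) * (1 - fps_X ^ Suc n) * (q_fact n * q_fact_inv n)"
    by (simp add: q_fact_mult_inv)
  also have "\<dots> = (q_fact (Suc n) * q_fact_inv (Suc n)) * q_fact_inv n"
    unfolding q_fact_Suc by (simp only: ac_simps)
  finally show ?thesis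
    by (simp add: q_fact_mult_inv)
qed

lemma bounded_overp_fps_product: "bounded_overp_fps n * q_fact n = q_fact_plus n"
proof (induction n)
  case 0
  show ?case
    by (rule fps_ext)
      (simp add: bounded_overp_fps_def bounded_overpartitions_0 q_fact_def q_fact_plus_def)
next
  case (Suc n)
  have "bounded_overp_fps (Suc n) * q_fact (Suc n) =
      (bounded_overp_fps (Suc n) * (1 - fps_X ^ Suc n)) * q_fact n"
    unfolding q_fact_Suc by (simp only: ac_simps)
  also have "\<dots> = (bounded_overp_fps n * q_fact n) * (1 + fps_X ^ Suc n)"
    unfolding bounded_overp_fps_Suc by (simp only: ac_simps)
  finally show ?case
    by (simp only: Suc q_fact_plus_Suc)
qed

section \<open>Gauss's identity\<close>

text \<open>
  Finite form of the identity: \<open>\<Sum>\<^sub>|\<^sub>j\<^sub>|\<^sub>\<le>\<^sub>n (-1)\<^sup>j q\<^bsup>j\<^sup>2\<^esup> / ((q)\<^bsub>n-j\<^esub> (q)\<^bsub>n+j\<^esub>) = 1 / (q\<^sup>2; q\<^sup>2)\<^sub>n\<close>.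
  It is proved by telescoping in \<open>j\<close> with the certificate \<open>theta_cert\<close>; the terms for \<open>j\<close> and \<open>-j\<close>
  are combined so that \<open>j\<close> ranges over natural numbers.
\<close>

definition theta_term :: "nat \<Rightarrow> nat \<Rightarrow> int fps" where
  "theta_term n j = (- 1) ^ j * fps_X ^ (j\<^sup>2) * q_fact_inv (n - j) * q_fact_inv (n + j)"

definition theta_sum :: "nat \<Rightarrow> int fps" where
  "theta_sum n = theta_term n 0 + 2 * (\<Sum>j=1..n. theta_term n j)"

definition theta_cert :: "nat \<Rightarrow> nat \<Rightarrow> int fps" where
  "theta_cert n j = (- 1) ^ j * fps_X ^ (j\<^sup>2 - j + n) * q_fact_inv (n - j) * q_fact_inv (n + j - 1)"

lemma theta_term_telescope:
  assumes "1 \<le> j" "j \<le> n"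
  shows "(1 - fps_X ^ (2 * Suc n)) * theta_term (Suc n) j - theta_term n j =
    theta_cert (Suc n) j - theta_cert (Suc n) (Suc j)"
proof -
  obtain d where d: "n = j + d"
    using assms(2) le_Suc_ex by blast
  \<comment> \<open>Here x = q^(n+1-j), y = q^j and s = q^(j^2-j). Once \<open>a\<close> and
    \<open>b\<close> absorb the inverse products, the claim is a polynomial identity in these five
    quantities.\<close>
  define x where "x = (fps_X :: int fps) ^ Suc d"
  define y where "y = (fps_X :: int fps) ^ j"
  define s where "s = (fps_X :: int fps) ^ (j\<^sup>2 - j)"
  have jj: "j \<le> j\<^sup>2"
    using assms by (simp add: power2_eq_square)
  have "2 * Suc n = (Suc d + j) * 2" "Suc (n + j) = Suc d + j * 2"
    by (simp_all add: d)
  then have q1: "fps_X ^ (2 * Suc n) = (x * y)\<^sup>2" "fps_X ^ Suc d = x"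
      "fps_X ^ Suc (n + j) = x * y\<^sup>2"
    unfolding x_def y_def by (simp_all only: power_mult power_add)
  have q2: "(fps_X :: int fps) ^ (j\<^sup>2) = s * y"
    using jj by (simp add: s_def y_def flip: power_add)
  have "j\<^sup>2 - j + Suc n = (j\<^sup>2 - j) + Suc d + j"
    by (simp add: d)
  then have q3: "fps_X ^ (j\<^sup>2 - j + Suc n) = s * x * y"
    unfolding s_def x_def y_def by (simp only: power_add)
  have q4: "fps_X ^ ((Suc j)\<^sup>2 - Suc j + Suc n) = s * x * y ^ 3"
  proof -
    have "(Suc j)\<^sup>2 = j\<^sup>2 + 2 * j + 1"
      by (simp add: power2_eq_square)
    then have "(Suc j)\<^sup>2 - Suc j + Suc n = (j\<^sup>2 - j) + Suc d + j * 3"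
      using jj d by linarith
    then show ?thesis
      unfolding s_def x_def y_def by (simp only: power_add power_mult)
  qed
  define a where "a = q_fact_inv (Suc d)"
  define b where "b = q_fact_inv (Suc (n + j))"
  have a: "q_fact_inv d = a * (1 - x)"
    using q_fact_inv_Suc[of d] by (simp add: a_def q1 del: power_Suc)
  have b: "q_fact_inv (n + j) = b * (1 - x * y\<^sup>2)"
    using q_fact_inv_Suc[of "n + j"] by (simp add: b_def q1 del: power_Suc)
  have idx: "Suc n - j = Suc d" "n - j = d" "Suc n + j = Suc (n + j)" "Suc n - Suc j = d"
    "Suc (n + j) - 1 = n + j" "Suc n + Suc j - 1 = Suc (n + j)"
    by (simp_all add: d)
  show ?thesis
    unfolding theta_term_def theta_cert_def idx q2 q3 q4 q1(1) a b
    unfolding a_def[symmetric] b_def[symmetric] power_Suc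
    by (simp add: algebra_simps power2_eq_square power3_eq_cube)
qed

lemma theta_term_telescope_0:
  "(1 - fps_X ^ (2 * Suc n)) * theta_term (Suc n) 0 - theta_term n 0 = - 2 * theta_cert (Suc n) 1"
proof -
  define x where "x = (fps_X :: int fps) ^ Suc n"
  define a where "a = q_fact_inv (Suc n)"
  have a: "q_fact_inv n = a * (1 - x)"
    using q_fact_inv_Suc[of n] by (simp add: a_def x_def del: power_Suc)
  have q: "fps_X ^ (2 * Suc n) = x\<^sup>2"
    unfolding x_def by (simp only: power_mult[symmetric] mult.commute)
  show ?thesis
    unfolding theta_term_def theta_cert_def q
    by (simp add: a flip: a_def x_def power_Suc) (simp add: algebra_simps power2_eq_square)
qed

lemma theta_term_telescope_last:
  "(1 - fps_X ^ (2 * Suc n)) * theta_term (Suc n) (Suc n) = theta_cert (Suc n) (Suc n)"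
proof -
  have e: "(Suc n)\<^sup>2 - Suc n + Suc n = (Suc n)\<^sup>2"
    by (simp add: power2_eq_square)
  have i: "Suc n + Suc n - 1 = 2 * n + 1" "Suc n + Suc n = Suc (2 * n + 1)" "2 * Suc n = Suc (2 * n + 1)"
    by simp_all
  show ?thesis
    unfolding theta_term_def theta_cert_def e i(1) q_fact_inv_Suc[of "2 * n + 1", symmetric]
    unfolding i by (simp only: ac_simps)
qed

text \<open>All boundary terms cancel: j = 0 contributes -2 cert(1), the doubled telescoping sum 2
  cert(1) - 2 cert(n+1), and the new index j = n + 1 contributes 2 cert(n+1).\<close>

lemma theta_sum_Suc: "(1 - fps_X ^ (2 * Suc n)) * theta_sum (Suc n) = theta_sum n"
proof -
  define c where "c = (1 - fps_X ^ (2 * Suc n) :: int fps)"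
  have "c * theta_sum (Suc n) - theta_sum n = (c * theta_term (Suc n) 0 - theta_term n 0) +
      2 * ((\<Sum>j=1..n. c * theta_term (Suc n) j - theta_term n j) + c * theta_term (Suc n) (Suc n))"
    by (simp add: theta_sum_def algebra_simps sum_distrib_left sum_subtractf)
  also have "(\<Sum>j=1..n. c * theta_term (Suc n) j - theta_term n j) =
      (\<Sum>j=1..n. theta_cert (Suc n) j - theta_cert (Suc n) (Suc j))"
    unfolding c_def by (intro sum.cong refl theta_term_telescope) auto
  also have "\<dots> = theta_cert (Suc n) 1 - theta_cert (Suc n) (Suc n)"
    using sum_Suc_diff[of 1 n "\<lambda>j. - theta_cert (Suc n) j"] by simp
  finally show ?thesis
    unfolding c_def theta_term_telescope_0 theta_term_telescope_last by simp
qed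

text \<open>The product \<open>q_fact n * q_fact_plus n\<close> is (q^2;q^2)_n, whose new factor is
  the one removed by \<open>theta_sum_Suc\<close>.\<close>

lemma theta_sum_product: "q_fact n * q_fact_plus n * theta_sum n = 1"
proof (induction n)
  case 0
  have "q_fact_inv 0 = 1"
    using q_fact_mult_inv[of 0] by (simp add: q_fact_def)
  then show ?case
    by (simp add: theta_sum_def theta_term_def q_fact_def q_fact_plus_def)
next
  case (Suc n)
  have "(1 - fps_X ^ Suc n) * (1 + fps_X ^ Suc n) = (1 - fps_X ^ (2 * Suc n) :: int fps)"
    by (simp add: algebra_simps flip: power_add mult_2)
  then have "q_fact (Suc n) * q_fact_plus (Suc n) * theta_sum (Suc n) =
      q_fact n * q_fact_plus n * ((1 - fps_X ^ (2 * Suc n)) * theta_sum (Suc n))"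
    unfolding q_fact_Suc q_fact_plus_Suc by (metis (no_types, lifting) mult.assoc mult.left_commute)
  then show ?case
    unfolding theta_sum_Suc Suc .
qed

section \<open>Passage to the limit, as congruences modulo powers of q\<close>

lemma fps_X_power_dvd_iff:
  "fps_X ^ n dvd (f :: 'a :: comm_ring_1 fps) \<longleftrightarrow> (\<forall>m<n. f $ m = 0)"
proof
  assume "fps_X ^ n dvd f"
  then show "\<forall>m<n. f $ m = 0"
    by (auto simp: dvd_def fps_X_power_mult_nth)
next
  assume "\<forall>m<n. f $ m = 0"
  then have "f = fps_X ^ n * fps_shift n f"
    by (intro fps_ext) (simp add: fps_X_power_mult_nth)
  then show "fps_X ^ n dvd f"
    by (rule dvdI)
qed

lemma q_fact_cong: "fps_X ^ Suc m dvd q_fact (m + d) - q_fact m"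
proof (induction d)
  case (Suc d)
  have "(fps_X :: int fps) ^ Suc m dvd fps_X ^ Suc (m + d)"
    by (rule le_imp_power_dvd) simp
  then have "fps_X ^ Suc m dvd (q_fact (m + d) - q_fact m) - q_fact (m + d) * fps_X ^ Suc (m + d)"
    by (intro dvd_diff Suc dvd_mult)
  then show ?case
    by (simp add: q_fact_Suc algebra_simps)
qed simp

text \<open>The factor (q;q)_(n-j) agrees with (q;q)_n only modulo q^(n-j+1). The factor q^(j^2)
  makes up for the loss, since j <= j^2.\<close>

lemma theta_term_cong:
  assumes "j \<le> n"
  shows "fps_X ^ Suc n dvd (q_fact n)\<^sup>2 * theta_term n j - (- 1) ^ j * fps_X ^ (j\<^sup>2)"
proof -
  define d where "d = n - j"
  have n: "n = d + j"
    using assms by (simp add: d_def)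
  let ?E = "q_fact n" and ?E1 = "q_fact d" and ?E2 = "q_fact (n + j)"
  let ?e1 = "q_fact_inv d" and ?e2 = "q_fact_inv (n + j)"
  have "fps_X ^ Suc d dvd ?E - ?E1"
    using q_fact_cong[of d j] by (simp add: n)
  moreover have "fps_X ^ Suc d dvd ?E2 - ?E"
    by (rule dvd_trans[OF le_imp_power_dvd q_fact_cong]) (simp add: n)
  ultimately have "fps_X ^ Suc d dvd ?E * (?E - ?E1) - ?E1 * (?E2 - ?E)"
    by (metis dvd_diff dvd_mult)
  then have "fps_X ^ Suc d dvd ?E\<^sup>2 - ?E1 * ?E2"
    by (simp add: algebra_simps power2_eq_square)
  then have dvd: "fps_X ^ (j\<^sup>2) * fps_X ^ Suc d dvd
      fps_X ^ (j\<^sup>2) * ((?E\<^sup>2 - ?E1 * ?E2) * ((- 1) ^ j * ?e1 * ?e2))"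
    by (intro mult_dvd_mono dvd_refl dvd_mult2)
  have "(fps_X :: int fps) ^ Suc n dvd fps_X ^ (j\<^sup>2) * fps_X ^ Suc d"
    unfolding power_add[symmetric]
    by (rule le_imp_power_dvd) (simp add: n power2_eq_square)
  also note dvd
  also have "fps_X ^ (j\<^sup>2) * ((?E\<^sup>2 - ?E1 * ?E2) * ((- 1) ^ j * ?e1 * ?e2)) =
      ?E\<^sup>2 * theta_term n j - (- 1) ^ j * fps_X ^ (j\<^sup>2) * (?E1 * ?e1) * (?E2 * ?e2)"
    unfolding theta_term_def d_def by (simp add: algebra_simps)
  also have "\<dots> = ?E\<^sup>2 * theta_term n j - (- 1) ^ j * fps_X ^ (j\<^sup>2)"
    by (simp add: q_fact_mult_inv)
  finally show ?thesis .
qed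

text \<open>Half of \<open>\<phi>(-q) - 1\<close>: the exponent of the sign may be taken to be \<open>m = j\<^sup>2\<close>
  instead of \<open>j\<close>.\<close>

definition half_theta :: "int fps" where
  "half_theta = Abs_fps (\<lambda>m. if \<exists>j>0. m = j\<^sup>2 then (- 1) ^ m else 0)"

lemma half_theta_cong:
  "fps_X ^ Suc n dvd half_theta - (\<Sum>j=1..n. (- 1) ^ j * fps_X ^ (j\<^sup>2))"
proof -
  have "(\<Sum>j=1..n. (- 1) ^ j * fps_X ^ (j\<^sup>2)) $ m = half_theta $ m" if "m \<le> n" for m
  proof -
    have "(\<Sum>j=1..n. (- 1) ^ j * fps_X ^ (j\<^sup>2)) $ m =
        (\<Sum>j=1..n. if m = j\<^sup>2 then (- 1) ^ m else (0 :: int))"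
      unfolding fps_sum_nth
    proof (intro sum.cong refl)
      fix j
      have "((- 1) ^ j :: int fps) = fps_const ((- 1) ^ j)"
        by (simp add: fps_const_power[symmetric] fps_const_neg[symmetric] del: fps_const_neg)
      then show "((- 1) ^ j * fps_X ^ j\<^sup>2) $ m = (if m = j\<^sup>2 then (- 1) ^ m else (0 :: int))"
        by (simp add: fps_X_power_nth minus_one_power_iff)
    qed
    also have "\<dots> = half_theta $ m"
    proof (cases "\<exists>j>0. m = j\<^sup>2")
      case True
      then obtain i where i: "i > 0" "m = i\<^sup>2" by blast
      have "i \<le> m"
        using i by (simp add: power2_eq_square)
      then have "i \<in> {1..n}"
        using i that by auto
      moreover have "(m = j\<^sup>2) = (j = i)" for j
        using i by auto
      ultimately show ?thesis
        using True by (simp add: half_theta_def)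
    next
      case False
      then have "\<forall>j\<in>{1..n}. m \<noteq> j\<^sup>2"
        by force
      then show ?thesis
        using False by (simp add: half_theta_def)
    qed
    finally show ?thesis .
  qed
  then show ?thesis
    by (intro fps_X_power_dvd_iff[THEN iffD2]) simp
qed

text \<open>Modulo q^(n+1), the series of \<open>overp\<close> agrees with G =
  \<open>bounded_overp_fps n\<close>, and 1 + 2 \<open>half_theta\<close> with (q;q)_n^2
  \<open>theta_sum n\<close>. The product of these two approximations is exactly 1.\<close>

lemma overp_fps_mult_theta: "Abs_fps (\<lambda>m. int (overp m)) * (1 + 2 * half_theta) = 1"
proof (rule fps_ext)
  fix n
  let ?O = "Abs_fps (\<lambda>m. int (overp m))" and ?G = "bounded_overp_fps n"
  let ?E = "q_fact n" and ?T = "\<Sum>j=1..n. (- 1) ^ j * (fps_X :: int fps) ^ (j\<^sup>2)"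
  have "fps_X ^ Suc n dvd ?E\<^sup>2 * theta_term n 0 - 1"
    using theta_term_cong[of 0 n] by simp
  moreover have "fps_X ^ Suc n dvd (\<Sum>j=1..n. ?E\<^sup>2 * theta_term n j - (- 1) ^ j * fps_X ^ (j\<^sup>2))"
    by (intro dvd_sum theta_term_cong) auto
  ultimately have "fps_X ^ Suc n dvd (?E\<^sup>2 * theta_term n 0 - 1) +
      2 * (\<Sum>j=1..n. ?E\<^sup>2 * theta_term n j - (- 1) ^ j * fps_X ^ (j\<^sup>2)) -
      2 * (half_theta - ?T)"
    by (metis (no_types, lifting) dvd_add dvd_diff dvd_mult half_theta_cong)
  also have "\<dots> = ?E\<^sup>2 * theta_sum n - (1 + 2 * half_theta)"
    by (simp add: theta_sum_def algebra_simps sum_subtractf sum_distrib_left)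
  finally have 1: "fps_X ^ Suc n dvd ?E\<^sup>2 * theta_sum n - (1 + 2 * half_theta)" .
  have "?G * (?E\<^sup>2 * theta_sum n) = (?G * ?E) * ?E * theta_sum n"
    by (simp add: power2_eq_square ac_simps)
  also have "\<dots> = 1"
    using theta_sum_product[of n] unfolding bounded_overp_fps_product by (simp add: ac_simps)
  finally have 2: "?G * (?E\<^sup>2 * theta_sum n) = 1" .
  have 3: "fps_X ^ Suc n dvd ?O - ?G"
    by (intro fps_X_power_dvd_iff[THEN iffD2])
      (simp add: bounded_overp_fps_def card_bounded_overpartitions_eq_overp)
  have "fps_X ^ Suc n dvd (?O - ?G) * (1 + 2 * half_theta) -
      ?G * (?E\<^sup>2 * theta_sum n - (1 + 2 * half_theta))"
    by (intro dvd_diff dvd_mult2[OF 3] dvd_mult[OF 1])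
  also have "\<dots> = ?O * (1 + 2 * half_theta) - 1"
    using 2 by (simp add: algebra_simps)
  finally have "(?O * (1 + 2 * half_theta) - 1) $ n = 0"
    unfolding fps_X_power_dvd_iff by simp
  then show "(?O * (1 + 2 * half_theta)) $ n = 1 $ n"
    by simp
qed

section \<open>Reduction modulo 16\<close>

lemma overp_cong_16:
  assumes "N > 0"
  shows "[int (overp N) = - 2 * half_theta $ N + 4 * (half_theta ^ 2) $ N - 8 * (half_theta ^ 3) $ N] (mod 16)"
proof -
  define t where "t = half_theta"
  define P where "P = Abs_fps (\<lambda>m. int (overp m))"
  have "P * (1 + 2 * t) = 1"
    unfolding P_def t_def by (rule overp_fps_mult_theta)
  \<comment> \<open>Truncated geometric series: (1 + 2t)(1 - 2t + 4t^2 - 8t^3) = 1 - 16t^4.\<close>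
  moreover have "P = P * (1 + 2 * t) * (1 - 2 * t + 4 * t ^ 2 - 8 * t ^ 3) + 16 * (t ^ 4 * P)"
    by (simp add: algebra_simps power2_eq_square power3_eq_cube power4_eq_xxxx)
  ultimately have "P = 1 - 2 * t + 4 * t ^ 2 - 8 * t ^ 3 + 16 * (t ^ 4 * P)"
    by simp
  also have "\<dots> $ N = 1 $ N - 2 * t $ N + 4 * (t ^ 2) $ N - 8 * (t ^ 3) $ N + 16 * (t ^ 4 * P) $ N"
    by (simp add: numeral_fps_const)
  finally have *: "int (overp N) =
      1 $ N - 2 * t $ N + 4 * (t ^ 2) $ N - 8 * (t ^ 3) $ N + 16 * (t ^ 4 * P) $ N"
    by (simp add: P_def)
  show ?thesis
    unfolding cong_iff_dvd_diff * t_def[symmetric] using assms by simp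
qed

section \<open>Parity of coefficients by involutions\<close>

lemma even_card_involution:
  assumes "\<And>x. x \<in> X \<Longrightarrow> h x \<in> X" "\<And>x. x \<in> X \<Longrightarrow> h (h x) = x" "\<And>x. x \<in> X \<Longrightarrow> h x \<noteq> x"
  shows "even (card X)"
proof -
  \<comment> \<open>In the two-element field each pair {x, h x} contributes 1 + 1 = 0.\<close>
  have "(\<Sum>x\<in>X. 1 :: bit) = 0"
    by (rule sum_involution_eq_0[of X _ h]) (use assms in auto)
  then have "even (of_nat (card X) :: bit)"
    by simp
  then show ?thesis
    by (simp only: even_of_nat_iff)
qed

text \<open>In the Cauchy product the terms at i and n - i are equal and cancel modulo 2; only the
  middle term i = n/2 survives.\<close>

lemma fps_square_parity:
  fixes f :: "int fps"
  shows "odd ((f ^ 2) $ n) \<longleftrightarrow> even n \<and> odd (f $ (n div 2))"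
proof -
  let ?g = "\<lambda>i. f $ i * f $ (n - i)"
  let ?D = "{i \<in> {0..n}. 2 * i = n}"
  have "even (card {i \<in> {0..n} - ?D. odd (?g i)})"
    by (rule even_card_involution[where h = "\<lambda>i. n - i"]) auto
  then have "even (sum ?g ({0..n} - ?D))"
    by (simp add: even_sum_iff)
  moreover have "(f ^ 2) $ n = sum ?g ({0..n} - ?D) + sum ?g ?D"
    unfolding power2_eq_square fps_mult_nth by (rule sum.subset_diff) auto
  moreover have "odd (sum ?g ?D) \<longleftrightarrow> even n \<and> odd (f $ (n div 2))"
  proof (cases "even n")
    case True
    then have "?D = {n div 2}" by auto
    moreover have "n - n div 2 = n div 2"
      using True by auto
    ultimately show ?thesis
      using True by simp
  next
    case False
    then have "?D = {}" by auto
    then show ?thesis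
      using False by (simp only: sum.empty) simp
  qed
  ultimately show ?thesis
    by simp
qed

lemma odd_half_theta_nth: "odd (half_theta $ n) \<longleftrightarrow> (\<exists>x>0. n = x\<^sup>2)"
  by (simp add: half_theta_def)

lemma odd_half_theta_square_nth: "odd ((half_theta ^ 2) $ n) \<longleftrightarrow> (\<exists>y>0. n = 2 * y\<^sup>2)"
  unfolding fps_square_parity odd_half_theta_nth by auto

text \<open>In the Cauchy product of theta and theta^2, the odd terms sit at i = x^2 with N - i =
  2y^2. Such an i determines the positive pair (x, y).\<close>

lemma half_theta_cube_parity:
  "even ((half_theta ^ 3) $ N) \<longleftrightarrow>
    even (card {(x, y). 0 < x \<and> 0 < y \<and> x\<^sup>2 + 2 * y\<^sup>2 = N})"
proof -
  let ?S = "{(x, y). 0 < x \<and> 0 < y \<and> x\<^sup>2 + 2 * y\<^sup>2 = N}"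
  have "(half_theta ^ 3) $ N = (\<Sum>i=0..N. half_theta $ i * (half_theta ^ 2) $ (N - i))"
    by (simp add: power3_eq_cube power2_eq_square fps_mult_nth mult.assoc)
  then have "even ((half_theta ^ 3) $ N) \<longleftrightarrow>
      even (card {i \<in> {0..N}. odd (half_theta $ i) \<and> odd ((half_theta ^ 2) $ (N - i))})"
    by (simp add: even_sum_iff)
  also have "{i \<in> {0..N}. odd (half_theta $ i) \<and> odd ((half_theta ^ 2) $ (N - i))} =
      (\<lambda>(x, y). x\<^sup>2) ` ?S"
    unfolding odd_half_theta_nth odd_half_theta_square_nth
  proof (intro equalityI subsetI)
    fix i assume "i \<in> {i \<in> {0..N}. (\<exists>x>0. i = x\<^sup>2) \<and> (\<exists>y>0. N - i = 2 * y\<^sup>2)}"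
    then obtain x y where "i \<le> N" "x > 0" "i = x\<^sup>2" "y > 0" "N - i = 2 * y\<^sup>2"
      by auto
    then have "(x, y) \<in> ?S" "i = (\<lambda>(x, y). x\<^sup>2) (x, y)"
      by auto
    then show "i \<in> (\<lambda>(x, y). x\<^sup>2) ` ?S"
      by blast
  qed auto
  also have "card ((\<lambda>(x, y). x\<^sup>2) ` ?S) = card ?S"
    by (intro card_image) (auto simp: inj_on_def)
  finally show ?thesis .
qed

text \<open>Zero is allowed in \<open>two\<close>, which thus also rules out N = 0 and square N. The
  terms in theta and theta^2 vanish, and 8 times an even number remains.\<close>

lemma dvd_16_overp:
  assumes two: "\<And>x y. N \<noteq> x\<^sup>2 + y\<^sup>2"
    and "even (card {(x, y). 0 < x \<and> 0 < y \<and> x\<^sup>2 + 2 * y\<^sup>2 = N})"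
  shows "16 dvd overp N"
proof -
  have N: "N > 0"
    using two[of 0 0] by simp
  have "half_theta $ N = 0"
    using two[of _ 0] by (simp add: half_theta_def)
  moreover have "half_theta $ i * half_theta $ (N - i) = 0" if "i \<le> N" for i
  proof (rule ccontr)
    assume "half_theta $ i * half_theta $ (N - i) \<noteq> 0"
    then obtain x y where "i = x\<^sup>2" "N - i = y\<^sup>2"
      by (auto simp: half_theta_def split: if_splits)
    then show False
      using two[of x y] that by simp
  qed
  then have "(half_theta ^ 2) $ N = 0"
    unfolding power2_eq_square fps_mult_nth by (intro sum.neutral) auto
  moreover have "even ((half_theta ^ 3) $ N)"
    using assms(2) half_theta_cube_parity by blast
  ultimately have "[int (overp N) = 0] (mod 16)"
    using overp_cong_16[OF N] by (auto elim!: evenE simp: cong_def)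
  then show ?thesis
    by (simp add: cong_0_iff flip: int_dvd_int_iff)
qed

section \<open>Representations by binary forms\<close>

text \<open>If 3 divides one of x and y, it divides the other, and then 9 divides N.\<close>

lemma norm_not_dvd_3:
  fixes x y N :: int
  assumes "x\<^sup>2 + 2 * y\<^sup>2 = N" "3 dvd N" "\<not> 9 dvd N"
  shows "\<not> 3 dvd x" "\<not> 3 dvd y"
proof -
  have p: "prime (3 :: int)" by simp
  have *: "9 dvd x\<^sup>2 + 2 * y\<^sup>2" if "3 dvd x" "3 dvd y"
    using that by (auto elim!: dvdE simp: power_mult_distrib)
  have "3 dvd x \<Longrightarrow> 3 dvd 2 * y\<^sup>2"
    using assms by (metis dvd_add_right_iff dvd_mult power2_eq_square)
  then have 1: "3 dvd x \<Longrightarrow> 3 dvd y"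
    using p by (auto simp: prime_dvd_mult_iff prime_dvd_power_iff)
  have "3 dvd y \<Longrightarrow> 3 dvd x\<^sup>2"
    using assms by (metis dvd_add_left_iff dvd_mult power2_eq_square)
  then have 2: "3 dvd y \<Longrightarrow> 3 dvd x"
    using p by (auto simp: prime_dvd_power_iff)
  show "\<not> 3 dvd x" "\<not> 3 dvd y"
    using * 1 2 assms by auto
qed

text \<open>Multiplication of \<open>x + y \<surd>-2\<close> by whichever of \<open>(1 \<plusminus> \<surd>-2) / (1 \<mp> \<surd>-2)\<close> keeps it
  integral, followed by taking absolute values.\<close>

definition twist :: "int \<times> int \<Rightarrow> int \<times> int" where
  "twist = (\<lambda>(x, y). if 3 dvd x + y then ((x + 4 * y) div 3, \<bar>2 * x - y\<bar> div 3)
     else (\<bar>x - 4 * y\<bar> div 3, (2 * x + y) div 3))"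

text \<open>Writing x = 3a - y, and x = 3a + y for the other branch, makes the divisions in
  \<open>twist\<close> exact.\<close>

lemma twist_sum: "twist (3 * a - y, y) = (a + y, \<bar>2 * a - y\<bar>)"
proof -
  have "2 * (3 * a - y) - y = 3 * (2 * a - y)"
    by simp
  then show ?thesis
    by (simp add: twist_def abs_mult)
qed

lemma twist_diff:
  assumes "\<not> 3 dvd y"
  shows "twist (3 * a + y, y) = (\<bar>a - y\<bar>, 2 * a + y)"
proof -
  have "3 * a + y - 4 * y = 3 * (a - y)" "2 * (3 * a + y) + y = 3 * (2 * a + y)"
    by simp_all
  moreover have "\<not> 3 dvd 3 * a + y + y"
    using assms by presburger
  ultimately show ?thesis
    by (simp add: twist_def abs_mult)
qed

lemma even_card_norm_reps_int:
  fixes N :: int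
  assumes N: "3 dvd N" "\<not> 9 dvd N" and six: "\<And>s. N \<noteq> 6 * s\<^sup>2" and three: "\<And>s. N \<noteq> 3 * s\<^sup>2"
  shows "even (card {(x, y). 0 < x \<and> 0 < y \<and> x\<^sup>2 + 2 * y\<^sup>2 = N})" (is "even (card ?S)")
proof -
  have main: "twist p \<in> ?S \<and> twist (twist p) = p \<and> twist p \<noteq> p" if p: "p \<in> ?S" for p
  proof -
    obtain x y where xy: "p = (x, y)" "0 < x" "0 < y" "x\<^sup>2 + 2 * y\<^sup>2 = N"
      using p by auto
    note nd = norm_not_dvd_3[OF _ N]
    have y: "\<not> 3 dvd y" "\<not> 3 dvd x"
      using nd xy by auto
    have "3 dvd x + y \<or> 3 dvd x - y"
      using y by presburger
    then consider (A) "3 dvd x + y" | (B) "3 dvd x - y"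
      by blast
    then show ?thesis
    proof cases
      case A
      then obtain a where a: "x = 3 * a - y"
        by (metis add_diff_cancel_right' dvdE)
      have t: "twist p = (a + y, \<bar>2 * a - y\<bar>)"
        unfolding xy a by (rule twist_sum)
      have n: "(a + y)\<^sup>2 + 2 * \<bar>2 * a - y\<bar>\<^sup>2 = N"
        using xy(4) unfolding a by (simp add: power2_eq_square algebra_simps)
      note nd' = nd[OF n]
      \<comment> \<open>The image has norm N again, so its coordinates are prime to 3, hence
        nonzero.\<close>
      have "2 * a - y \<noteq> 0"
        using nd'(2) by auto
      then have S: "twist p \<in> ?S"
        using n xy a unfolding t by auto
      have inv: "twist (twist p) = p"
      \<comment> \<open>The sign lost in the absolute value decides which branch the second
        application of \<open>twist\<close> takes.\<close>
      proof (cases "2 * a \<ge> y")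
        case True
        then have "twist p = (3 * a - (2 * a - y), 2 * a - y)"
          unfolding t by simp
        then have "twist (twist p) = (a + (2 * a - y), \<bar>2 * a - (2 * a - y)\<bar>)"
          by (simp only: twist_sum)
        then show ?thesis
          using xy a by simp
      next
        case False
        then have "twist p = (3 * a + (y - 2 * a), y - 2 * a)"
          unfolding t by simp
        moreover have "\<not> 3 dvd y - 2 * a"
          using False nd'(2) by simp
        ultimately have "twist (twist p) = (\<bar>a - (y - 2 * a)\<bar>, 2 * a + (y - 2 * a))"
          by (simp only: twist_diff not_False_eq_True)
        then show ?thesis
          using xy a by simp
      qed
      \<comment> \<open>A fixed point has a = y, so x = 2y and N = 6y^2; in the other branch a = 0,
        so x = y and N = 3y^2.\<close>
      have "twist p \<noteq> p"
      proof
        assume "twist p = p"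
        then have "a + y = 3 * a - y"
          unfolding t by (simp add: xy(1) a)
        then have "a = y"
          by simp
        then show False
          using xy(4) six[of y] a by (simp add: power_mult_distrib)
      qed
      then show ?thesis
        using S inv by blast
    next
      case B
      then obtain a where a: "x = 3 * a + y"
        by (metis diff_add_cancel dvdE)
      have t: "twist p = (\<bar>a - y\<bar>, 2 * a + y)"
        unfolding xy a using y(1) by (rule twist_diff)
      have n: "\<bar>a - y\<bar>\<^sup>2 + 2 * (2 * a + y)\<^sup>2 = N"
        using xy(4) unfolding a by (simp add: power2_eq_square algebra_simps)
      note nd' = nd[OF n]
      have "a - y \<noteq> 0"
        using nd'(1) by auto
      then have S: "twist p \<in> ?S"
        using n xy a unfolding t by auto
      have inv: "twist (twist p) = p"
      proof (cases "a \<ge> y")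
        case True
        then have "twist p = (3 * a - (2 * a + y), 2 * a + y)"
          unfolding t by simp
        then have "twist (twist p) = (a + (2 * a + y), \<bar>2 * a - (2 * a + y)\<bar>)"
          by (simp only: twist_sum)
        then show ?thesis
          using xy a by simp
      next
        case False
        then have "twist p = (3 * (- a) + (2 * a + y), 2 * a + y)"
          unfolding t by simp
        then have "twist (twist p) = (\<bar>- a - (2 * a + y)\<bar>, 2 * (- a) + (2 * a + y))"
          using nd'(2) by (simp only: twist_diff not_False_eq_True)
        then show ?thesis
          using xy a by simp
      qed
      have "twist p \<noteq> p"
      proof
        assume "twist p = p"
        then have "a = 0"
          unfolding t by (simp add: xy(1))
        then show False
          using xy(4) three[of y] a by simp
      qed
      then show ?thesis
        using S inv by blast
    qed
  qed
  show ?thesis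
  proof (rule even_card_involution)
    fix p assume "p \<in> ?S"
    then have p: "twist p \<in> ?S \<and> twist (twist p) = p \<and> twist p \<noteq> p"
      by (rule main)
    show "twist p \<in> ?S"
      using p by (rule conjunct1)
    show "twist (twist p) = p" "twist p \<noteq> p"
      using p by simp_all
  qed
qed

lemma even_card_norm_reps:
  fixes m :: nat
  assumes "odd m" "\<not> 3 dvd m" "\<And>s. m \<noteq> s\<^sup>2"
  shows "even (card {(x, y). 0 < x \<and> 0 < y \<and> x\<^sup>2 + 2 * y\<^sup>2 = 6 * m})" (is "even (card ?S)")
proof -
  let ?T = "{(x, y). 0 < x \<and> 0 < y \<and> x\<^sup>2 + 2 * y\<^sup>2 = int (6 * m)}"
  have "?T = map_prod int int ` ?S"
  proof (intro equalityI subsetI)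
    fix p assume "p \<in> ?T"
    then obtain x y where p: "p = (x, y)" "0 < x" "0 < y" "x\<^sup>2 + 2 * y\<^sup>2 = int (6 * m)"
      by auto
    then have "int ((nat x)\<^sup>2 + 2 * (nat y)\<^sup>2) = int (6 * m)"
      by simp
    then have "(nat x)\<^sup>2 + 2 * (nat y)\<^sup>2 = 6 * m"
      by (simp only: of_nat_eq_iff)
    then have "(nat x, nat y) \<in> ?S" "p = map_prod int int (nat x, nat y)"
      using p by auto
    then show "p \<in> map_prod int int ` ?S"
      by blast
  next
    fix p assume "p \<in> map_prod int int ` ?S"
    then obtain x y where p: "p = (int x, int y)" "0 < x" "0 < y" "x\<^sup>2 + 2 * y\<^sup>2 = 6 * m"
      by auto
    have "(int x)\<^sup>2 + 2 * (int y)\<^sup>2 = int (6 * m)"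
      unfolding p(4)[symmetric] by simp
    then show "p \<in> ?T"
      using p by simp
  qed
  then have "card ?T = card ?S"
    by (simp only:) (rule card_image, auto simp: inj_on_def)
  moreover have "even (card ?T)"
  proof (rule even_card_norm_reps_int)
    show "3 dvd int (6 * m)" by simp
    show "\<not> 9 dvd int (6 * m)"
      using assms(2) by presburger
    show "int (6 * m) \<noteq> 6 * s\<^sup>2" for s
      using assms(3)[of "nat \<bar>s\<bar>"] by (auto simp: nat_power_eq[symmetric])
    \<comment> \<open>Here s^2 = 2m would make s even, hence m even.\<close>
    show "int (6 * m) \<noteq> 3 * s\<^sup>2" for s
    proof
      assume *: "int (6 * m) = 3 * s\<^sup>2"
      then have s: "s\<^sup>2 = 2 * int m" by simp
      then have "even s"
        by (metis dvd_triv_left even_power)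
      then obtain b where "s = 2 * b" ..
      then have "int m = 2 * b\<^sup>2"
        using s by (simp add: power_mult_distrib)
      then have "even (int m)"
        by simp
      then show False
        using assms(1) by simp
    qed
  qed
  ultimately show ?thesis
    by simp
qed

section \<open>Local obstructions modulo 7 and 3\<close>

lemma square_form_mod:
  fixes x y c p :: nat
  shows "(x\<^sup>2 + c * y\<^sup>2) mod p = ((x mod p)\<^sup>2 + c * (y mod p)\<^sup>2) mod p"
  by (intro mod_add_cong mod_mult_cong refl) (simp_all add: power_mod)

text \<open>Neither -1 nor -2 is a square modulo 7, so 7 must divide both x and y.\<close>

lemma square_form_7_dvd:
  fixes x y c :: nat
  assumes "c \<in> {1, 2}" "7 dvd x\<^sup>2 + c * y\<^sup>2"
  shows "49 dvd x\<^sup>2 + c * y\<^sup>2"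
proof -
  have "x mod 7 \<in> {0, 1, 2, 3, 4, 5, 6}" "y mod 7 \<in> {0, 1, 2, 3, 4, 5, 6}"
    by (simp; presburger)+
  moreover have "((x mod 7)\<^sup>2 + c * (y mod 7)\<^sup>2) mod 7 = 0"
    by (rule trans[OF square_form_mod[symmetric] dvd_imp_mod_0[OF assms(2)]])
  ultimately have "x mod 7 = 0 \<and> y mod 7 = 0"
    using assms(1) by (elim insertE emptyE) simp_all
  then show ?thesis
    by (auto elim!: dvdE simp: power_mult_distrib simp flip: dvd_eq_mod_eq_0)
qed

lemma sum_squares_3_dvd:
  fixes x y :: nat
  assumes "3 dvd x\<^sup>2 + y\<^sup>2"
  shows "9 dvd x\<^sup>2 + y\<^sup>2"
proof -
  have "x mod 3 \<in> {0, 1, 2}" "y mod 3 \<in> {0, 1, 2}"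
    by (simp; presburger)+
  moreover have "((x mod 3)\<^sup>2 + 1 * (y mod 3)\<^sup>2) mod 3 = 0"
    using assms square_form_mod[of x 1 y 3] by (simp add: dvd_eq_mod_eq_0)
  ultimately have "x mod 3 = 0 \<and> y mod 3 = 0"
    by (elim insertE emptyE) simp_all
  then show ?thesis
    by (auto elim!: dvdE simp: power_mult_distrib simp flip: dvd_eq_mod_eq_0)
qed

lemma dvd_16_overp_6:
  assumes "odd m" "\<not> 3 dvd m" "\<And>s. m \<noteq> s\<^sup>2"
  shows "16 dvd overp (6 * m)"
proof (rule dvd_16_overp)
  show "6 * m \<noteq> x\<^sup>2 + y\<^sup>2" for x y
  proof
    assume *: "6 * m = x\<^sup>2 + y\<^sup>2"
    have "3 dvd 6 * m" by simp
    then have "9 dvd 6 * m"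
      unfolding * by (rule sum_squares_3_dvd)
    then show False
      using assms(2) by presburger
  qed
qed (rule even_card_norm_reps[OF assms])

lemma dvd_16_overp_7:
  assumes "\<not> 7 dvd m"
  shows "16 dvd overp (7 * m)"
proof (rule dvd_16_overp)
  \<comment> \<open>The case c = 1 excludes sums of two squares; c = 2 empties the set of solutions
    to be counted.\<close>
  have no_rep: "7 * m \<noteq> x\<^sup>2 + c * y\<^sup>2" if "c \<in> {1, 2}" for c x y :: nat
  proof
    assume *: "7 * m = x\<^sup>2 + c * y\<^sup>2"
    have "7 dvd 7 * m" by simp
    then have "49 dvd 7 * m"
      unfolding * by (rule square_form_7_dvd[OF that])
    then show False
      using assms by presburger
  qed
  show "7 * m \<noteq> x\<^sup>2 + y\<^sup>2" for x y
    using no_rep[of 1 x y] by simp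
  have "x\<^sup>2 + 2 * y\<^sup>2 \<noteq> 7 * m" for x y
    using no_rep[of 2 x y] by simp
  then have "{(x, y). 0 < x \<and> 0 < y \<and> x\<^sup>2 + 2 * y\<^sup>2 = 7 * m} = {}"
    by auto
  then show "even (card {(x, y). 0 < x \<and> 0 < y \<and> x\<^sup>2 + 2 * y\<^sup>2 = 7 * m})"
    by (simp only: card.empty) simp
qed

section \<open>The four progressions\<close>

lemma not_square_by_residue:
  fixes m p :: nat
  assumes "\<And>a. a < p \<Longrightarrow> a\<^sup>2 mod p \<noteq> m mod p" "p > 0"
  shows "m \<noteq> s\<^sup>2"
proof
  assume "m = s\<^sup>2"
  then have "m mod p = (s mod p)\<^sup>2 mod p"
    by (simp add: power_mod)
  then show False
    using assms by (metis mod_less_divisor)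
qed

theorem theorem3:
  fixes A B n :: nat
  assumes "(A, B) \<in> {(36, 30), (72, 42), (196, 70), (252, 114)}"
  shows "[overp (A * n + B) = 0] (mod 16)"
proof -
  consider (36) "A = 36" "B = 30" | (72) "A = 72" "B = 42"
    | (196) "A = 196" "B = 70" | (252) "A = 252" "B = 114"
    using assms by auto
  \<comment> \<open>The arguments factor as 6(6n + 5), 6(12n + 7), 7(28n + 10) and 6(42n + 19). The
    cofactors of 6 are nonsquares modulo 3, 4 and 7 respectively.\<close>
  then have "16 dvd overp (A * n + B)"
  proof cases
    case 36
    have "(6 * n + 5) mod 3 = 2"
      by presburger
    moreover have "a\<^sup>2 mod 3 \<noteq> 2" if "a < 3" for a :: nat
    proof -
      have "a \<in> {0, 1, 2}"
        using that by (simp; presburger)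
      then show ?thesis
        by (elim insertE emptyE) simp_all
    qed
    ultimately have nonsquare: "6 * n + 5 \<noteq> s\<^sup>2" for s
      using not_square_by_residue[of 3 "6 * n + 5"] by simp
    have "16 dvd overp (6 * (6 * n + 5))"
      by (rule dvd_16_overp_6[OF _ _ nonsquare]) presburger+
    then show ?thesis
      using 36 by (simp add: algebra_simps)
  next
    case 72
    have "(12 * n + 7) mod 4 = 3"
      by presburger
    moreover have "a\<^sup>2 mod 4 \<noteq> 3" if "a < 4" for a :: nat
    proof -
      have "a \<in> {0, 1, 2, 3}"
        using that by (simp; presburger)
      then show ?thesis
        by (elim insertE emptyE) simp_all
    qed
    ultimately have nonsquare: "12 * n + 7 \<noteq> s\<^sup>2" for s
      using not_square_by_residue[of 4 "12 * n + 7"] by simp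
    have "16 dvd overp (6 * (12 * n + 7))"
      by (rule dvd_16_overp_6[OF _ _ nonsquare]) presburger+
    then show ?thesis
      using 72 by (simp add: algebra_simps)
  next
    case 196
    have "16 dvd overp (7 * (28 * n + 10))"
      by (rule dvd_16_overp_7) presburger
    then show ?thesis
      using 196 by (simp add: algebra_simps)
  next
    case 252
    have "(42 * n + 19) mod 7 = 5"
      by presburger
    moreover have "a\<^sup>2 mod 7 \<noteq> 5" if "a < 7" for a :: nat
    proof -
      have "a \<in> {0, 1, 2, 3, 4, 5, 6}"
        using that by (simp; presburger)
      then show ?thesis
        by (elim insertE emptyE) simp_all
    qed
    ultimately have nonsquare: "42 * n + 19 \<noteq> s\<^sup>2" for s
      using not_square_by_residue[of 7 "42 * n + 19"] by simp
    have "16 dvd overp (6 * (42 * n + 19))"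
      by (rule dvd_16_overp_6[OF _ _ nonsquare]) presburger+
    then show ?thesis
      using 252 by (simp add: algebra_simps)
  qed
  then show ?thesis
    by (simp add: cong_0_iff)
qed

end
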